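(* If the basic sequence $Q$ is infinite in limit, then $RN(Q)\setminus\bigcup_{k=1}^\infty N_k(Q)\ne\emptyset$, so $RN(Q)\setminus N(Q)\ne\emptyset$.
   Context: A basic sequence is a sequence $Q=(q_n)_{n\ge1}$ of integers $q_n\ge 2$. The $Q$-Cantor series expansion of $x\in\mathbb{R}$ is the unique expansion $x=E_0+\sum_{n\ge1}\frac{E_n}{q_1\cdots q_n}$ with $E_0=\lfloor x\rfloor$, $E_n\in\{0,\ldots,q_n-1\}$ for $n\ge 1$, and $E_n\ne q_n-1$ infinitely often. $Q$ is infinite in limit if $q_n\to\infty$. Put $Q_n^{(k)}=\sum_{j=1}^n\frac1{q_jq_{j+1}\cdots q_{j+k-1}}$. A block of length $k$ is an ordered $k$-tuple of non-negative integers, and $N_n^Q(B,x)$ is the number of occurrences of $B$ starting at positions $\le n$ in the digits $E_1,E_2,\ldots$ of $x$. $N_k(Q)$ is the set of $x\in\mathbb{R}$ with $\lim_nN_n^Q(B,x)/Q_n^{(k)}=1$ for all blocks $B$ of length $k$, and $N(Q)=\bigcap_{k\ge1}N_k(Q)$. $RN(Q)$ is the set of $x\in\mathbb{R}$ with $\lim_nN_n^Q(B_1,x)/N_n^Q(B_2,x)=1$ for all $k\ge1$ and all blocks $B_1,B_2$ of length $k$. *)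

theory Defs
  imports "HOL-Analysis.Analysis"
begin

text \<open>
  Sequences are indexed from 1 as in the source: a basic sequence is a function
  \<open>q :: nat \<Rightarrow> nat\<close> whose value \<open>q 0\<close> is never used. Digit sequences are
  \<open>E :: nat \<Rightarrow> int\<close>, since \<open>E 0\<close> is the (possibly negative) integer part.
\<close>

definition basic_seq :: "(nat \<Rightarrow> nat) \<Rightarrow> bool" where
  "basic_seq q \<longleftrightarrow> (\<forall>n\<ge>1. 2 \<le> q n)"

definition infinite_in_limit :: "(nat \<Rightarrow> nat) \<Rightarrow> bool" where
  "infinite_in_limit q \<longleftrightarrow> filterlim q at_top sequentially"

definition is_cantor_expansion :: "(nat \<Rightarrow> nat) \<Rightarrow> real \<Rightarrow> (nat \<Rightarrow> int) \<Rightarrow> bool" where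
  "is_cantor_expansion q x E \<longleftrightarrow>
     E 0 = \<lfloor>x\<rfloor> \<and>
     (\<forall>n\<ge>1. 0 \<le> E n \<and> E n \<le> int (q n) - 1) \<and>
     infinite {n. 1 \<le> n \<and> E n \<noteq> int (q n) - 1} \<and>
     (\<lambda>n. real_of_int (E (Suc n)) / real (\<Prod>i=1..Suc n. q i)) sums (x - real_of_int (E 0))"

text \<open>Well-defined for basic sequences by \<open>cantor_expansion_ex1\<close> below.\<close>

definition cantor_digits :: "(nat \<Rightarrow> nat) \<Rightarrow> real \<Rightarrow> nat \<Rightarrow> int" where
  "cantor_digits q x = (THE E. is_cantor_expansion q x E)"

definition Q_sum :: "(nat \<Rightarrow> nat) \<Rightarrow> nat \<Rightarrow> nat \<Rightarrow> real" where
  "Q_sum q k n = (\<Sum>j=1..n. 1 / real (\<Prod>i\<in>{j..<j+k}. q i))"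

text \<open>A block of length \<open>k\<close> is a list \<open>B :: nat list\<close> with \<open>length B = k\<close>. Only the starting
  position of an occurrence is bounded by \<open>n\<close>; position 0 (the integer part) is excluded.\<close>

definition block_count :: "(nat \<Rightarrow> nat) \<Rightarrow> nat list \<Rightarrow> real \<Rightarrow> nat \<Rightarrow> nat" where
  "block_count q B x n =
     card {i \<in> {1..n}. \<forall>j<length B. cantor_digits q x (i + j) = int (B ! j)}"

definition normal_order :: "(nat \<Rightarrow> nat) \<Rightarrow> nat \<Rightarrow> real set" where
  "normal_order q k =
     {x. \<forall>B. length B = k \<longrightarrow>
        (\<lambda>n. real (block_count q B x n) / Q_sum q k n) \<longlonglongrightarrow> 1}"

definition normal_set :: "(nat \<Rightarrow> nat) \<Rightarrow> real set" where
  "normal_set q = (\<Inter>k\<in>{1..}. normal_order q k)"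

text \<open>Division by zero yields 0 here, so the limit being 1 forces the denominator to be
  eventually nonzero; a ratio that is undefined infinitely often never has limit 1.\<close>

definition ratio_normal_set :: "(nat \<Rightarrow> nat) \<Rightarrow> real set" where
  "ratio_normal_set q =
     {x. \<forall>k\<ge>1. \<forall>B1 B2. length B1 = k \<longrightarrow> length B2 = k \<longrightarrow>
        (\<lambda>n. real (block_count q B1 x n) / real (block_count q B2 x n)) \<longlonglongrightarrow> 1}"

lemma basic_seq_prod_ge:
  assumes "basic_seq q"
  shows "2 ^ n \<le> (\<Prod>i=1..n. real (q i))"
proof (induction n)
  case (Suc n)
  have "2 \<le> real (q (Suc n))"
    using assms unfolding basic_seq_def by (metis le_add1 of_nat_le_iff of_nat_numeral plus_1_eq_Suc)
  then have "2 ^ n * 2 \<le> (\<Prod>i=1..n. real (q i)) * real (q (Suc n))"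
    using Suc by (intro mult_mono) (auto intro: prod_nonneg)
  then show ?case by (simp add: prod.nat_ivl_Suc')
qed simp

lemma basic_seq_prod_pos:
  assumes "basic_seq q"
  shows "0 < (\<Prod>i=1..n. real (q i))"
  using basic_seq_prod_ge[OF assms, of n] by (smt (verit) zero_less_power)

lemma is_cantor_expansion_remainder:
  assumes q: "basic_seq q" and E: "is_cantor_expansion q x E"
  obtains T where "T 0 = x - \<lfloor>x\<rfloor>"
    "\<And>n. T (Suc n) = real (q (Suc n)) * T n - real_of_int (E (Suc n))"
    "\<And>n. 0 \<le> T n \<and> T n < (1::real)"
proof -
  define P where "P n = (\<Prod>i=1..n. real (q i))" for n
  define a where "a n = real_of_int (E (Suc n)) / P (Suc n)" for n
  define T where "T n = P n * (x - \<lfloor>x\<rfloor> - sum a {..<n})" for n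
  have Ppos: "0 < P n" for n unfolding P_def using q by (rule basic_seq_prod_pos)
  have PS: "P (Suc n) = real (q (Suc n)) * P n" for n
    by (simp add: P_def prod.nat_ivl_Suc')
  have q2: "2 \<le> real (q (Suc n))" for n
    using q unfolding basic_seq_def by (metis le_add1 of_nat_le_iff of_nat_numeral plus_1_eq_Suc)
  have E0: "0 \<le> E (Suc n)" and E1: "E (Suc n) \<le> int (q (Suc n)) - 1" for n
    using E unfolding is_cantor_expansion_def by auto
  have Einf: "infinite {n. 1 \<le> n \<and> E n \<noteq> int (q n) - 1}"
    using E unfolding is_cantor_expansion_def by auto
  have sums: "a sums (x - \<lfloor>x\<rfloor>)"
    using E unfolding is_cantor_expansion_def a_def P_def by auto
  have a0: "0 \<le> a n" for n unfolding a_def using E0 Ppos by (simp add: less_imp_le)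
  have T0: "T 0 = x - \<lfloor>x\<rfloor>" by (simp add: T_def P_def)
  have TS: "T (Suc n) = real (q (Suc n)) * T n - real_of_int (E (Suc n))" for n
    using Ppos[of n] q2[of n] by (simp add: T_def PS a_def field_simps)
  have Tge: "0 \<le> T n" for n
  proof -
    have "sum a {..<n} \<le> x - \<lfloor>x\<rfloor>"
      using sums a0 by (metis sum_le_suminf sums_iff finite_lessThan)
    then show ?thesis unfolding T_def using Ppos[of n] by simp
  qed
  have part: "sum a {..<m} \<le> sum a {..<n} + 1 / P n - 1 / P m" if "n \<le> m" for n m
    using that
  proof (induction m rule: dec_induct)
    case (step m)
    have "a m \<le> (real (q (Suc m)) - 1) / P (Suc m)"
      unfolding a_def using Ppos[of "Suc m"] E1[of m] by (intro divide_right_mono) linarith+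
    also have "\<dots> = 1 / P m - 1 / P (Suc m)"
      using Ppos[of m] q2[of m] by (simp add: PS field_simps)
    finally show ?case using step.IH by simp
  qed simp
  have Tle: "T n \<le> 1" for n
  proof -
    have "(\<lambda>m. sum a {..<m}) \<longlonglongrightarrow> x - \<lfloor>x\<rfloor>" using sums by (simp add: sums_def)
    moreover have "\<forall>m\<ge>n. sum a {..<m} \<le> sum a {..<n} + 1 / P n"
      using part[of n] Ppos by (smt (verit) zero_less_divide_1_iff)
    ultimately have "x - \<lfloor>x\<rfloor> \<le> sum a {..<n} + 1 / P n" by (meson LIMSEQ_le_const2)
    then have "x - \<lfloor>x\<rfloor> - sum a {..<n} \<le> 1 / P n" by simp
    then have "P n * (x - \<lfloor>x\<rfloor> - sum a {..<n}) \<le> P n * (1 / P n)"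
      using Ppos[of n] by (intro mult_left_mono) auto
    then show ?thesis unfolding T_def using Ppos[of n] by simp
  qed
  have down: "T n < 1" if "T (Suc n) < 1 \<or> E (Suc n) \<noteq> int (q (Suc n)) - 1" for n
  proof -
    have "real (q (Suc n)) * T n = real_of_int (E (Suc n)) + T (Suc n)" using TS by simp
    also have "\<dots> < real (q (Suc n))"
    proof (cases "E (Suc n) = int (q (Suc n)) - 1")
      case True
      then show ?thesis using that by simp
    next
      case False
      then have "E (Suc n) \<le> int (q (Suc n)) - 2" using E1[of n] by simp
      then have "real_of_int (E (Suc n)) \<le> real (q (Suc n)) - 2" by linarith
      then show ?thesis using Tle[of "Suc n"] by simp
    qed
    finally show ?thesis using q2[of n] by simp
  qed
  have "T n < 1" for n
  proof -
    obtain m where m: "n < m" "E m \<noteq> int (q m) - 1"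
      using Einf unfolding infinite_nat_iff_unbounded by blast
    then obtain l where l: "m = Suc l" "n \<le> l" by (cases m) auto
    have "T l < 1" using down m l by blast
    with \<open>n \<le> l\<close> show ?thesis
      by (induction n rule: inc_induct) (use down in auto)
  qed
  then show ?thesis using that T0 TS Tge by blast
qed

lemma cantor_expansion_unique:
  assumes q: "basic_seq q" and E: "is_cantor_expansion q x E" and F: "is_cantor_expansion q x F"
  shows "E = F"
proof -
  obtain T where T: "T 0 = x - \<lfloor>x\<rfloor>"
    "\<And>n. T (Suc n) = real (q (Suc n)) * T n - real_of_int (E (Suc n))"
    "\<And>n. 0 \<le> T n \<and> T n < (1::real)"
    using is_cantor_expansion_remainder[OF q E] by blast
  obtain U where U: "U 0 = x - \<lfloor>x\<rfloor>"
    "\<And>n. U (Suc n) = real (q (Suc n)) * U n - real_of_int (F (Suc n))"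
    "\<And>n. 0 \<le> U n \<and> U n < (1::real)"
    using is_cantor_expansion_remainder[OF q F] by blast
  have ET: "E (Suc n) = \<lfloor>real (q (Suc n)) * T n\<rfloor>" for n
    using T(2)[of n] T(3)[of "Suc n"] by linarith
  have FU: "F (Suc n) = \<lfloor>real (q (Suc n)) * U n\<rfloor>" for n
    using U(2)[of n] U(3)[of "Suc n"] by linarith
  have TU: "T n = U n" for n
    by (induction n) (simp_all add: T(1,2) U(1,2) ET FU)
  have "E n = F n" for n
    using E F by (cases n) (simp_all add: ET FU TU is_cantor_expansion_def)
  then show ?thesis by blast
qed

lemma cantor_expansion_exists:
  assumes q: "basic_seq q"
  shows "\<exists>E. is_cantor_expansion q x E"
proof -
  define P where "P n = (\<Prod>i=1..n. real (q i))" for n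
  define r where "r = rec_nat (frac x) (\<lambda>n y. frac (real (q (Suc n)) * y))"
  define E where "E n = (case n of 0 \<Rightarrow> \<lfloor>x\<rfloor> | Suc m \<Rightarrow> \<lfloor>real (q (Suc m)) * r m\<rfloor>)" for n
  have Ppos: "0 < P n" for n unfolding P_def using q by (rule basic_seq_prod_pos)
  have P2: "2 ^ n \<le> P n" for n unfolding P_def using q by (rule basic_seq_prod_ge)
  have PS: "P (Suc n) = real (q (Suc n)) * P n" for n
    by (simp add: P_def prod.nat_ivl_Suc')
  have q2: "2 \<le> real (q (Suc n))" for n
    using q unfolding basic_seq_def by (metis le_add1 of_nat_le_iff of_nat_numeral plus_1_eq_Suc)
  have r0: "r 0 = frac x" and rS: "r (Suc n) = frac (real (q (Suc n)) * r n)" for n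
    by (simp_all add: r_def)
  have rb: "0 \<le> r n \<and> r n < 1" for n
    by (cases n) (simp_all add: r0 rS frac_lt_1)
  have ES: "E (Suc n) = \<lfloor>real (q (Suc n)) * r n\<rfloor>" for n by (simp add: E_def)
  have rE: "r (Suc n) = real (q (Suc n)) * r n - real_of_int (E (Suc n))" for n
    by (simp add: rS ES frac_def)
  have range: "0 \<le> E (Suc n) \<and> E (Suc n) \<le> int (q (Suc n)) - 1" for n
  proof -
    have "0 \<le> real (q (Suc n)) * r n" using rb by simp
    moreover have "real (q (Suc n)) * r n < real (q (Suc n)) * 1"
      using rb q2[of n] by (intro mult_strict_left_mono) auto
    ultimately show ?thesis unfolding ES by (simp add: floor_less_iff)
  qed
  have partial: "(\<Sum>i<n. real_of_int (E (Suc i)) / P (Suc i)) = frac x - r n / P n" for n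
  proof (induction n)
    case 0
    then show ?case by (simp add: r0 P_def)
  next
    case (Suc n)
    have "r n / P n = real_of_int (E (Suc n)) / P (Suc n) + r (Suc n) / P (Suc n)"
      using Ppos[of n] q2[of n] by (simp add: rE PS field_simps)
    then show ?case using Suc by simp
  qed
  have "(\<lambda>n. r n / P n) \<longlonglongrightarrow> 0"
  proof (rule tendsto_sandwich[of "\<lambda>_. 0" _ _ "\<lambda>n. (1/2) ^ n"])
    have "r n / P n \<le> (1/2) ^ n" for n
    proof -
      have "r n / P n \<le> 1 / P n" using rb[of n] Ppos[of n] by (intro divide_right_mono) auto
      also have "\<dots> \<le> 1 / 2 ^ n" using P2[of n] Ppos[of n] by (intro divide_left_mono) auto
      finally show ?thesis by (simp add: power_divide)
    qed
    then show "\<forall>\<^sub>F n in sequentially. r n / P n \<le> (1/2) ^ n" by simp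
    show "\<forall>\<^sub>F n in sequentially. 0 \<le> r n / P n" using rb Ppos by (simp add: less_imp_le)
  qed (auto intro: LIMSEQ_power_zero)
  then have "(\<lambda>n. frac x - r n / P n) \<longlonglongrightarrow> frac x - 0" by (intro tendsto_diff tendsto_const)
  then have sums: "(\<lambda>n. real_of_int (E (Suc n)) / P (Suc n)) sums frac x"
    unfolding sums_def partial by simp
  have inf: "infinite {n. 1 \<le> n \<and> E n \<noteq> int (q n) - 1}"
  proof
    assume "finite {n. 1 \<le> n \<and> E n \<noteq> int (q n) - 1}"
    then obtain N where N: "\<And>n. 1 \<le> n \<Longrightarrow> E n \<noteq> int (q n) - 1 \<Longrightarrow> n \<le> N"
      unfolding finite_nat_set_iff_bounded_le by blast
    have step: "2 * (1 - r (N + m)) \<le> 1 - r (N + Suc m)" for m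
    proof -
      have "E (Suc (N + m)) = int (q (Suc (N + m))) - 1"
        using N[of "Suc (N + m)"] by fastforce
      then have "1 - r (Suc (N + m)) = real (q (Suc (N + m))) * (1 - r (N + m))"
        by (simp add: rE algebra_simps)
      moreover have "2 * (1 - r (N + m)) \<le> real (q (Suc (N + m))) * (1 - r (N + m))"
        using q2 rb[of "N + m"] by (intro mult_right_mono) auto
      ultimately show ?thesis by simp
    qed
    have grow: "2 ^ m * (1 - r N) \<le> 1 - r (N + m)" for m
    proof (induction m)
      case (Suc m)
      then show ?case using step[of m] by simp
    qed simp
    have pos: "0 < 1 - r N" using rb by simp
    obtain m where "1 / (1 - r N) < 2 ^ m" using real_arch_pow[of 2] by auto
    then have "1 < 2 ^ m * (1 - r N)" using pos by (simp add: field_simps)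
    then show False using grow[of m] rb[of "N + m"] by linarith
  qed
  have "is_cantor_expansion q x E"
    unfolding is_cantor_expansion_def
  proof (intro conjI allI impI)
    fix n :: nat assume "1 \<le> n"
    then obtain m where "n = Suc m" by (cases n) auto
    then show "0 \<le> E n" "E n \<le> int (q n) - 1" using range by auto
  qed (use inf sums in \<open>simp_all add: E_def P_def frac_def\<close>)
  then show ?thesis by blast
qed

lemma cantor_expansion_ex1:
  assumes "basic_seq q"
  shows "\<exists>!E. is_cantor_expansion q x E"
  using cantor_expansion_exists[OF assms] cantor_expansion_unique[OF assms] by blast

lemma cantor_digits_eqI:
  assumes "basic_seq q" "is_cantor_expansion q x E"
  shows "cantor_digits q x = E"
  unfolding cantor_digits_def
  using assms(2) by (rule the1_equality[OF cantor_expansion_ex1[OF assms(1)]])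

end

theory Submission
  imports Defs
begin

text \<open>
  Among all words of length \<open>m\<close> over \<open>{0..<m}\<close>, all blocks of a fixed length occur equally
  often. A round consists of these words, separated by gaps. The digits of \<open>x\<close> are a sequence of
  rounds with \<open>m \<rightarrow> \<infinity>\<close> so slowly that a single round is negligible compared with the
  previous ones; this gives ratio normality. Gaps carry the digit \<open>q n - 2\<close>, which exceeds every
  fixed digit eventually because \<open>q n \<rightarrow> \<infinity>\<close>, so they contribute finitely many occurrences of a
  block. The gaps between rounds can be made so long that, for every \<open>k\<close> with unbounded
  \<open>Q_sum q k\<close>, the block counts are at most half of \<open>Q_sum q k\<close> infinitely often; if
  \<open>Q_sum q k\<close> is bounded, unbounded block counts already rule out normality of order \<open>k\<close>.
\<close>

section \<open>Occurrences of a block in a finite word\<close>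

text \<open>Near the end of \<open>u\<close>, \<open>take\<close> returns a shorter list, so a block
  that runs past the end is not counted. The bound on \<open>r\<close> keeps the set finite when
  \<open>B = []\<close>.\<close>

definition occurrences :: "'a list \<Rightarrow> 'a list \<Rightarrow> nat" where
  "occurrences B u = card {r. r < length u \<and> take (length B) (drop r u) = B}"

lemma occurrences_Nil [simp]: "occurrences B [] = 0"
  by (simp add: occurrences_def)

lemma occurrences_Cons:
  "occurrences B (x # u) = of_bool (take (length B) (x # u) = B) + occurrences B u"
proof -
  let ?S = "{r. r < length u \<and> take (length B) (drop r u) = B}"
  have "{r. r < length (x # u) \<and> take (length B) (drop r (x # u)) = B} =
      (if take (length B) (x # u) = B then {0} else {}) \<union> Suc ` ?S" (is "?L = _")
  proof (rule set_eqI)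
    fix r
    show "r \<in> ?L \<longleftrightarrow> r \<in> (if take (length B) (x # u) = B then {0} else {}) \<union> Suc ` ?S"
      by (cases r) auto
  qed
  moreover have "card ((if take (length B) (x # u) = B then {0} else {}) \<union> Suc ` ?S) =
      of_bool (take (length B) (x # u) = B) + card ?S"
    by (subst card_Un_disjoint) (auto simp: card_image)
  ultimately show ?thesis by (simp add: occurrences_def)
qed

lemma occurrences_le_length: "occurrences B u \<le> length u"
proof -
  have "occurrences B u \<le> card {..<length u}"
    unfolding occurrences_def by (intro card_mono) auto
  then show ?thesis by simp
qed

text \<open>\<open>None\<close> is never a letter of \<open>map Some B\<close>, so a prefix equal to
  the block cannot reach the separator behind \<open>w\<close>. If \<open>B\<close> is longer than
  \<open>w\<close>, both sides are false.\<close>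

lemma take_map_Some_eq_iff:
  "take (length B) (map Some w @ None # v) = map Some B \<longleftrightarrow> take (length B) w = B"
proof (cases "length B \<le> length w")
  case True
  then have "take (length B) (map Some w @ None # v) = map Some (take (length B) w)"
    by (simp add: take_map)
  then show ?thesis by (simp add: inj_map_eq_map)
next
  case False
  then have "None \<in> set (take (length B) (map Some w @ None # v))"
    by (auto simp: take_Cons' not_le)
  moreover have "None \<notin> set (map Some B)" by auto
  ultimately have "take (length B) (map Some w @ None # v) \<noteq> map Some B" by metis
  moreover have "take (length B) w \<noteq> B"
    using False by (metis length_take min.absorb_iff1 min.commute)
  ultimately show ?thesis by blast
qed

text \<open>No occurrence straddles a separator. This is what makes counts additive over the words
  of a round.\<close>

lemma occurrences_append_None:
  assumes "B \<noteq> []"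
  shows "occurrences (map Some B) (map Some w @ None # v) =
    occurrences B w + occurrences (map Some B) v"
proof (induction w)
  case Nil
  have "take (length B) (None # v) \<noteq> map Some B"
    using assms by (cases B) auto
  then show ?case by (simp add: occurrences_Cons)
next
  case (Cons x w)
  have "occurrences (map Some B) (map Some (x # w) @ None # v) =
      of_bool (take (length B) (map Some (x # w) @ None # v) = map Some B) +
      occurrences (map Some B) (map Some w @ None # v)"
    by (simp add: occurrences_Cons)
  then show ?case
    unfolding take_map_Some_eq_iff Cons.IH by (simp add: occurrences_Cons)
qed

lemma occurrences_concat_None:
  assumes "B \<noteq> []"
  shows "occurrences (map Some B) (concat (map (\<lambda>w. map Some w @ [None]) ws)) =
    (\<Sum>w\<leftarrow>ws. occurrences B w)"
  by (induction ws) (simp_all add: occurrences_append_None[OF assms])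

section \<open>Equidistribution of blocks over all words of a given length\<close>

lemma sum_list_n_lists_Suc:
  "(\<Sum>w\<leftarrow>List.n_lists (Suc l) xs. f w) = (\<Sum>w\<leftarrow>List.n_lists l xs. \<Sum>y\<leftarrow>xs. f (y # w))"
proof -
  have "sum_list (map f (concat (map (\<lambda>ys. map (\<lambda>y. y # ys) xs) vs))) =
      (\<Sum>w\<leftarrow>vs. \<Sum>y\<leftarrow>xs. f (y # w))" for vs
    by (induction vs) (simp_all add: comp_def)
  then show ?thesis by simp
qed

lemma sum_list_of_bool_eq:
  assumes "distinct xs" "b \<in> set xs"
  shows "(\<Sum>y\<leftarrow>xs. of_bool (y = b \<and> P)) = (of_bool P :: nat)"
  using assms
proof (induction xs)
  case (Cons x xs)
  show ?case
  proof (cases "x = b")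
    case True
    have "(\<Sum>y\<leftarrow>xs. of_bool (y = b \<and> P)) = (0::nat)"
      using Cons.prems True by (auto simp: sum_list_eq_0_iff)
    then show ?thesis using True by simp
  next
    case False
    then show ?thesis using Cons by simp
  qed
qed simp

text \<open>The first \<open>length B\<close> letters are forced and the others are free. What
  matters later is that the value depends on \<open>B\<close> only through its length.\<close>

lemma count_n_lists_prefix:
  assumes "distinct xs" "set B \<subseteq> set xs"
  shows "(\<Sum>w\<leftarrow>List.n_lists l xs. of_bool (take (length B) w = B)) =
    (if length B \<le> l then length xs ^ (l - length B) else (0::nat))"
  using assms(2)
proof (induction B arbitrary: l)
  case Nil
  then show ?case by (simp add: sum_list_triv length_n_lists)
next
  case (Cons b B)
  show ?case
  proof (cases l)
    case (Suc l')
    have "(\<Sum>w\<leftarrow>List.n_lists l xs. of_bool (take (length (b # B)) w = b # B)) =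
        (\<Sum>w\<leftarrow>List.n_lists l' xs. \<Sum>y\<leftarrow>xs. of_bool (y = b \<and> take (length B) w = B) :: nat)"
      unfolding Suc sum_list_n_lists_Suc by simp
    also have "\<dots> = (\<Sum>w\<leftarrow>List.n_lists l' xs. of_bool (take (length B) w = B))"
      using Cons.prems by (simp only: sum_list_of_bool_eq[OF assms(1)] list.set_intros subset_iff)
    finally show ?thesis using Cons Suc by simp
  qed simp
qed

text \<open>An occurrence in \<open>y # w\<close> is either a prefix or an occurrence in
  \<open>w\<close>. The number of prefixes depends only on the length of the block, and the rest is
  the induction hypothesis, repeated once for each choice of \<open>y\<close>.\<close>

lemma sum_occurrences_n_lists_cong:
  assumes "distinct xs" "set B \<subseteq> set xs" "set B' \<subseteq> set xs" "length B = length B'"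
  shows "(\<Sum>w\<leftarrow>List.n_lists l xs. occurrences B w) = (\<Sum>w\<leftarrow>List.n_lists l xs. occurrences B' w)"
proof (induction l)
  case (Suc l)
  have eq: "(\<Sum>w\<leftarrow>List.n_lists (Suc l) xs. occurrences D w) =
      (\<Sum>w\<leftarrow>List.n_lists (Suc l) xs. of_bool (take (length D) w = D)) +
      length xs * (\<Sum>w\<leftarrow>List.n_lists l xs. occurrences D w)" for D
    unfolding sum_list_n_lists_Suc occurrences_Cons sum_list_addf
    by (simp add: sum_list_triv sum_list_const_mult)
  show ?case
    unfolding eq Suc.IH count_n_lists_prefix[OF assms(1,2)] count_n_lists_prefix[OF assms(1,3)]
    using assms(4) by simp
qed simp

text \<open>\<open>None\<close> stands for a gap position.\<close>

definition round_word :: "nat \<Rightarrow> nat option list" where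
  "round_word m = concat (map (\<lambda>w. map Some w @ [None]) (List.n_lists m [0..<m]))"

lemma round_word_digit:
  assumes "Some d \<in> set (round_word m)"
  shows "d < m"
proof -
  obtain w where "w \<in> set (List.n_lists m [0..<m])" "Some d \<in> set (map Some w @ [None])"
    using assms unfolding round_word_def set_concat set_map by blast
  then have "set w \<subseteq> {0..<m}" "d \<in> set w" by (auto simp: set_n_lists)
  then show ?thesis by auto
qed

lemma occurrences_round_word_cong:
  assumes "B \<noteq> []" "set B \<subseteq> {..<m}" "set B' \<subseteq> {..<m}" "length B = length B'"
  shows "occurrences (map Some B) (round_word m) = occurrences (map Some B') (round_word m)"
proof -
  have "B' \<noteq> []" using assms by auto
  then show ?thesis
    unfolding round_word_def occurrences_concat_None[OF assms(1)] occurrences_concat_None[OF \<open>B' \<noteq> []\<close>]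
    using assms by (intro sum_occurrences_n_lists_cong) auto
qed

text \<open>The words that begin with \<open>B\<close> alone already contribute
  \<open>m ^ (m - length B)\<close> occurrences.\<close>

lemma occurrences_round_word_pos:
  assumes "B \<noteq> []" "set B \<subseteq> {..<m}" "length B \<le> m"
  shows "0 < occurrences (map Some B) (round_word m)"
proof -
  have "0 < m ^ (m - length B)" using assms by (cases m) auto
  also have "\<dots> = (\<Sum>w\<leftarrow>List.n_lists m [0..<m]. of_bool (take (length B) w = B))"
    using assms by (subst count_n_lists_prefix) auto
  also have "\<dots> \<le> (\<Sum>w\<leftarrow>List.n_lists m [0..<m]. occurrences B w)"
  proof (rule sum_list_mono)
    fix w :: "nat list"
    show "of_bool (take (length B) w = B) \<le> occurrences B w"
      using assms(1) by (cases w) (auto simp: occurrences_Cons)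
  qed
  finally show ?thesis
    by (simp add: round_word_def occurrences_concat_None[OF assms(1)])
qed

section \<open>Rounds of slowly growing size\<close>

text \<open>Choose the largest \<open>m \<le> t\<close> with \<open>m * f m \<le> t\<close>. The
  condition \<open>m \<le> t\<close> makes the set finite even where \<open>f\<close> vanishes, and
  a fixed \<open>M\<close> belongs to it as soon as \<open>t\<close> reaches
  \<open>M + M * f M\<close>.\<close>

lemma slow_sequence_exists:
  fixes f :: "nat \<Rightarrow> nat"
  obtains m :: "nat \<Rightarrow> nat"
  where "filterlim m at_top sequentially" "\<And>t. m t * f (m t) \<le> t"
proof
  define S where "S t = {m. m \<le> t \<and> m * f m \<le> t}" for t
  have fin: "finite (S t)" for t unfolding S_def by (rule finite_subset[of _ "{..t}"]) auto
  have "0 \<in> S t" for t by (simp add: S_def)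
  then have "Max (S t) \<in> S t" for t using fin by (intro Max_in) auto
  then show "Max (S t) * f (Max (S t)) \<le> t" for t by (auto simp: S_def)
  show "filterlim (\<lambda>t. Max (S t)) at_top sequentially"
    unfolding filterlim_at_top
  proof
    fix M
    have "M \<le> Max (S t)" if "M + M * f M \<le> t" for t
      using that fin by (intro Max_ge) (auto simp: S_def)
    then show "\<forall>\<^sub>F t in sequentially. M \<le> Max (S t)" unfolding eventually_sequentially by blast
  qed
qed

context
  fixes m :: "nat \<Rightarrow> nat"
  assumes m_lim: "filterlim m at_top sequentially"
begin

lemma eventually_occurrences_eq:
  assumes "B \<noteq> []" "length B = length B'"
  shows "\<forall>\<^sub>F t in sequentially.
    occurrences (map Some B) (round_word (m t)) = occurrences (map Some B') (round_word (m t))"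
proof -
  have "\<forall>\<^sub>F t in sequentially. Suc (Max (set B \<union> set B')) \<le> m t"
    using m_lim unfolding filterlim_at_top by blast
  then show ?thesis
  proof eventually_elim
    case (elim t)
    have "d < m t" if "d \<in> set B \<union> set B'" for d
      using elim Max_ge[OF _ that] by simp
    then show ?case using assms by (intro occurrences_round_word_cong) auto
  qed
qed

lemma eventually_occurrences_pos:
  assumes "B \<noteq> []"
  shows "\<forall>\<^sub>F t in sequentially. 0 < occurrences (map Some B) (round_word (m t))"
proof -
  have "\<forall>\<^sub>F t in sequentially. Suc (Max (set B)) + length B \<le> m t"
    using m_lim unfolding filterlim_at_top by blast
  then show ?thesis
  proof eventually_elim
    case (elim t)
    have "d < m t" if "d \<in> set B" for d
      using elim Max_ge[OF _ that] by simp
    then show ?case using assms elim by (intro occurrences_round_word_pos) auto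
  qed
qed

text \<open>From some \<open>t0\<close> on, every round contains the block at least once, so the sum
  is at least \<open>t - t0\<close>, which is at least half of \<open>t\<close> once
  \<open>t\<close> reaches \<open>2 * t0\<close>.\<close>

lemma eventually_sum_occurrences_ge:
  assumes "B \<noteq> []"
  shows "\<forall>\<^sub>F t in sequentially. t \<le> 2 * (\<Sum>s<t. occurrences (map Some B) (round_word (m s)))"
proof -
  obtain t0 where t0: "\<And>t. t0 \<le> t \<Longrightarrow> 0 < occurrences (map Some B) (round_word (m t))"
    using eventually_occurrences_pos[OF assms] unfolding eventually_sequentially by blast
  have "t \<le> 2 * (\<Sum>s<t. occurrences (map Some B) (round_word (m s)))" if "2 * t0 \<le> t" for t
  proof -
    have "t - t0 = (\<Sum>s\<in>{t0..<t}. 1)" by simp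
    also have "\<dots> \<le> (\<Sum>s\<in>{t0..<t}. occurrences (map Some B) (round_word (m s)))"
      using t0 by (intro sum_mono) (force simp: Suc_le_eq)
    also have "\<dots> \<le> (\<Sum>s<t. occurrences (map Some B) (round_word (m s)))"
      by (intro sum_mono2) auto
    finally show ?thesis using that by simp
  qed
  then show ?thesis unfolding eventually_sequentially by blast
qed

lemma filterlim_sum_occurrences:
  assumes "B \<noteq> []"
  shows "filterlim (\<lambda>t. real (\<Sum>s<t. occurrences (map Some B) (round_word (m s)))) at_top sequentially"
proof (rule filterlim_at_top_mono)
  show "filterlim (\<lambda>t. real t * (1/2)) at_top sequentially"
    by (intro filterlim_at_top_mult_tendsto_pos[OF tendsto_const] filterlim_real_sequentially) simp
  show "\<forall>\<^sub>F t in sequentially.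
      real t * (1/2) \<le> real (\<Sum>s<t. occurrences (map Some B) (round_word (m s)))"
    using eventually_sum_occurrences_ge[OF assms] by eventually_elim linarith
qed

text \<open>One round has at most \<open>t / m t\<close> occurrences, by \<open>slow\<close>, while
  the earlier ones together have at least \<open>t / 2\<close>. The quotient is therefore at most
  \<open>2 / m t\<close>.\<close>

lemma occurrences_div_sum_tendsto_0:
  assumes "B \<noteq> []" and slow: "\<And>t. m t * length (round_word (m t)) \<le> t"
  shows "(\<lambda>t. real (occurrences (map Some B) (round_word (m t))) /
    real (\<Sum>s<t. occurrences (map Some B) (round_word (m s)))) \<longlonglongrightarrow> 0"
proof (rule tendsto_sandwich[OF _ _ tendsto_const])
  have "filterlim (\<lambda>t. real (m t)) at_top sequentially"
    by (rule filterlim_compose[OF filterlim_real_sequentially m_lim])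
  then show "(\<lambda>t. 2 / real (m t)) \<longlonglongrightarrow> 0"
    by (intro tendsto_divide_0[OF tendsto_const] filterlim_at_top_imp_at_infinity)
  have "\<forall>\<^sub>F t in sequentially. 1 \<le> m t" using m_lim unfolding filterlim_at_top by blast
  then show "\<forall>\<^sub>F t in sequentially. real (occurrences (map Some B) (round_word (m t))) /
    real (\<Sum>s<t. occurrences (map Some B) (round_word (m s))) \<le> 2 / real (m t)"
    using eventually_sum_occurrences_ge[OF assms(1)] eventually_gt_at_top[of 0]
  proof eventually_elim
    case (elim t)
    let ?S = "\<Sum>s<t. occurrences (map Some B) (round_word (m s))"
    have "m t * occurrences (map Some B) (round_word (m t)) \<le> 2 * ?S"
      using slow[of t] elim(2) mult_le_mono2[OF occurrences_le_length[of "map Some B" "round_word (m t)"], of "m t"]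
      by linarith
    then have "real (m t) * real (occurrences (map Some B) (round_word (m t))) \<le> 2 * real ?S"
      by (metis of_nat_le_iff of_nat_mult of_nat_numeral)
    moreover have "0 < real ?S" using elim by linarith
    ultimately show ?case using elim by (simp add: field_simps del: of_nat_sum)
  qed
qed (simp add: sum_nonneg)

end

section \<open>Placing words along the positions with gaps between them\<close>

text \<open>The strict inequality leaves at least one gap position behind each word, so that no
  block can extend from one word into the next.\<close>

locale sparse_layout =
  fixes p :: "nat \<Rightarrow> nat" and u :: "nat \<Rightarrow> 'a option list"
  assumes gap: "p t + length (u t) < p (Suc t)"
begin

text \<open>Positions before \<open>p 0\<close> also get stage 0; the test
  \<open>p t \<le> n\<close> in \<open>symbol\<close> then turns them into gap positions.\<close>

definition stage :: "nat \<Rightarrow> nat" where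
  "stage n = (LEAST t. n < p (Suc t))"

definition symbol :: "nat \<Rightarrow> 'a option" where
  "symbol n = (let t = stage n in
     if p t \<le> n \<and> n < p t + length (u t) then u t ! (n - p t) else None)"

definition matches :: "'a list \<Rightarrow> nat \<Rightarrow> bool" where
  "matches B i \<longleftrightarrow> (\<forall>j<length B. symbol (i + j) = Some (B ! j))"

lemma strict_mono_p: "strict_mono p"
  using gap by (auto simp: strict_mono_Suc_iff intro: le_less_trans[OF le_add1])

lemma stage_eq:
  assumes "p t \<le> n" "n < p (Suc t)"
  shows "stage n = t"
  unfolding stage_def
proof (rule Least_equality)
  fix s assume "n < p (Suc s)"
  then have "p t < p (Suc s)" using assms by simp
  then show "t \<le> s" using strict_mono_less[OF strict_mono_p] by simp
qed (rule assms)

lemma less_p_Suc_stage: "n < p (Suc (stage n))"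
proof -
  have "n < p (Suc n)" using strict_mono_imp_increasing[OF strict_mono_p, of "Suc n"] by simp
  then show ?thesis unfolding stage_def by (rule LeastI)
qed

lemma p_stage_le:
  assumes "p 0 \<le> n"
  shows "p (stage n) \<le> n"
proof (cases "stage n")
  case (Suc s)
  then have "\<not> n < p (Suc s)" unfolding stage_def by (intro not_less_Least) simp
  then show ?thesis using Suc by simp
qed (use assms in simp)

lemma filterlim_stage: "filterlim stage at_top sequentially"
  unfolding filterlim_at_top
proof
  fix t
  have "t \<le> stage n" if "p t \<le> n" for n
  proof -
    have "p t < p (Suc (stage n))" using that less_p_Suc_stage by (rule le_less_trans)
    then show ?thesis using strict_mono_less[OF strict_mono_p] by simp
  qed
  then show "\<forall>\<^sub>F n in sequentially. t \<le> stage n" unfolding eventually_sequentially by blast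
qed

lemma symbol_stage:
  assumes "p t \<le> n" "n < p (Suc t)"
  shows "symbol n = (if n < p t + length (u t) then u t ! (n - p t) else None)"
  using assms by (simp add: symbol_def stage_eq)

lemma symbol_before: "n < p 0 \<Longrightarrow> symbol n = None"
  using strict_mono_less_eq[OF strict_mono_p, of 0 "stage n"] by (simp add: symbol_def Let_def)

lemma symbol_SomeD:
  assumes "symbol n = Some d"
  obtains t where "p t \<le> n" "Some d \<in> set (u t)"
proof
  have n: "p (stage n) \<le> n" "n < p (stage n) + length (u (stage n))"
      "u (stage n) ! (n - p (stage n)) = Some d"
    using assms by (auto simp: symbol_def Let_def split: if_splits)
  then have "n - p (stage n) < length (u (stage n))" by linarith
  then show "Some d \<in> set (u (stage n))" using n(3) nth_mem by metis
  show "p (stage n) \<le> n" by (rule n(1))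
qed

text \<open>An occurrence that starts in the stretch of word \<open>t\<close> lies entirely inside
  that word, because the position right behind the word is a gap. Counting in the layout thus
  reduces to counting in single words.\<close>

lemma matches_iff:
  assumes "B \<noteq> []" "p t \<le> i" "i < p (Suc t)"
  shows "matches B i \<longleftrightarrow>
    i - p t < length (u t) \<and> take (length B) (drop (i - p t) (u t)) = map Some B"
proof
  assume m: "matches B i"
  then have "symbol i = Some (B ! 0)" using assms(1) unfolding matches_def by force
  then have r: "i < p t + length (u t)"
    using symbol_stage[OF assms(2,3)] by (simp split: if_splits)
  \<comment> \<open>Otherwise the occurrence would cover the gap position
    \<open>p t + length (u t)\<close>.\<close>
  have le: "i + length B \<le> p t + length (u t)"
  proof (rule ccontr)
    assume "\<not> ?thesis"
    then have "p t + length (u t) - i < length B" using r by linarith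
    then have "symbol (p t + length (u t)) \<noteq> None"
      using m r unfolding matches_def by force
    then show False using symbol_stage[of t "p t + length (u t)"] gap[of t] by simp
  qed
  have "take (length B) (drop (i - p t) (u t)) = map Some B"
  proof (rule nth_equalityI)
    show "length (take (length B) (drop (i - p t) (u t))) = length (map Some B)"
      using le assms(2) by simp
  next
    fix j assume "j < length (take (length B) (drop (i - p t) (u t)))"
    then have j: "j < length B" by simp
    have "symbol (i + j) = u t ! (i + j - p t)"
      using symbol_stage[of t "i + j"] assms(2) j le gap[of t] by simp
    then show "take (length B) (drop (i - p t) (u t)) ! j = map Some B ! j"
      using m j le assms(2) unfolding matches_def by simp
  qed
  then show "i - p t < length (u t) \<and> take (length B) (drop (i - p t) (u t)) = map Some B"
    using r assms(2) by simp
next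
  assume *: "i - p t < length (u t) \<and> take (length B) (drop (i - p t) (u t)) = map Some B"
  then have "length (take (length B) (drop (i - p t) (u t))) = length B" by simp
  then have "length B \<le> length (u t) - (i - p t)" by simp
  then have le: "i + length B \<le> p t + length (u t)" using * assms(2) by linarith
  show "matches B i"
    unfolding matches_def
  proof (intro allI impI)
    fix j assume j: "j < length B"
    have "symbol (i + j) = u t ! (i - p t + j)"
      using symbol_stage[of t "i + j"] assms(2) j le gap[of t] by simp
    also have "\<dots> = take (length B) (drop (i - p t) (u t)) ! j" using j le assms(2) by simp
    also have "\<dots> = Some (B ! j)" using * j by simp
    finally show "symbol (i + j) = Some (B ! j)" .
  qed
qed

lemma card_matches_stage:
  assumes "B \<noteq> []"
  shows "card {i \<in> {p t..<p (Suc t)}. matches B i} = occurrences (map Some B) (u t)"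
proof -
  let ?R = "{r. r < length (u t) \<and> take (length (map Some B)) (drop r (u t)) = map Some B}"
  have "{i \<in> {p t..<p (Suc t)}. matches B i} = (+) (p t) ` ?R"
  proof (intro equalityI subsetI)
    fix i assume "i \<in> {i \<in> {p t..<p (Suc t)}. matches B i}"
    then show "i \<in> (+) (p t) ` ?R"
      using matches_iff[OF assms, of t i] by (intro image_eqI[of _ _ "i - p t"]) auto
  next
    fix i assume "i \<in> (+) (p t) ` ?R"
    then show "i \<in> {i \<in> {p t..<p (Suc t)}. matches B i}"
      using matches_iff[OF assms, of t i] gap[of t] by auto
  qed
  then show ?thesis by (simp add: occurrences_def card_image)
qed

lemma not_matches_before:
  assumes "B \<noteq> []" "i < p 0"
  shows "\<not> matches B i"
  using assms symbol_before[of i] by (force simp: matches_def)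

lemma card_matches_below:
  assumes "B \<noteq> []"
  shows "card {i. i < p t \<and> matches B i} = (\<Sum>s<t. occurrences (map Some B) (u s))"
proof (induction t)
  case 0
  then show ?case using not_matches_before[OF assms] by (simp add: card_eq_0_iff)
next
  case (Suc t)
  have "p t < p (Suc t)" using gap[of t] by simp
  then have eq: "{i. i < p (Suc t) \<and> matches B i} =
      {i. i < p t \<and> matches B i} \<union> {i \<in> {p t..<p (Suc t)}. matches B i}" by auto
  have "card ({i. i < p t \<and> matches B i} \<union> {i \<in> {p t..<p (Suc t)}. matches B i}) =
      card {i. i < p t \<and> matches B i} + card {i \<in> {p t..<p (Suc t)}. matches B i}"
    by (rule card_Un_disjoint) auto
  then show ?case
    unfolding eq by (simp only: Suc.IH card_matches_stage[OF assms] sum.lessThan_Suc)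
qed

text \<open>The two bounds differ by the current round only, which the slow growth of the rounds
  makes negligible.\<close>

lemma card_matches_bounds:
  assumes "B \<noteq> []" "p 0 \<le> n"
  shows "(\<Sum>s<stage n. occurrences (map Some B) (u s)) \<le> card {i. i \<le> n \<and> matches B i}"
    and "card {i. i \<le> n \<and> matches B i} \<le> (\<Sum>s<Suc (stage n). occurrences (map Some B) (u s))"
proof -
  have "{i. i < p (stage n) \<and> matches B i} \<subseteq> {i. i \<le> n \<and> matches B i}"
    using p_stage_le[OF assms(2)] by auto
  then have "card {i. i < p (stage n) \<and> matches B i} \<le> card {i. i \<le> n \<and> matches B i}"
    by (intro card_mono) simp_all
  then show "(\<Sum>s<stage n. occurrences (map Some B) (u s)) \<le> card {i. i \<le> n \<and> matches B i}"
    by (simp only: card_matches_below[OF assms(1)])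
  have "{i. i \<le> n \<and> matches B i} \<subseteq> {i. i < p (Suc (stage n)) \<and> matches B i}"
    using less_p_Suc_stage[of n] by auto
  then have "card {i. i \<le> n \<and> matches B i} \<le> card {i. i < p (Suc (stage n)) \<and> matches B i}"
    by (intro card_mono) simp_all
  then show "card {i. i \<le> n \<and> matches B i} \<le> (\<Sum>s<Suc (stage n). occurrences (map Some B) (u s))"
    by (simp only: card_matches_below[OF assms(1)])
qed

end

section \<open>Realizing a prescribed digit sequence\<close>

text \<open>Digits of at most \<open>q n - 2\<close> never take the maximal value, which settles
  admissibility, and they keep the value of the series strictly below 1, so the integer part is
  0.\<close>

lemma cantor_digits_surj:
  assumes q: "basic_seq q" and "E 0 = 0" and E: "\<And>n. 1 \<le> n \<Longrightarrow> 0 \<le> E n \<and> E n \<le> int (q n) - 2"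
  shows "\<exists>x. cantor_digits q x = E"
proof -
  define P where "P n = (\<Prod>i=1..n. real (q i))" for n
  define a where "a n = real_of_int (E (Suc n)) / P (Suc n)" for n
  have Ppos: "0 < P n" for n unfolding P_def using q by (rule basic_seq_prod_pos)
  have PS: "P (Suc n) = real (q (Suc n)) * P n" for n
    by (simp add: P_def prod.nat_ivl_Suc')
  have q2: "2 \<le> real (q (Suc n))" for n
    using q unfolding basic_seq_def by (metis le_add1 of_nat_le_iff of_nat_numeral plus_1_eq_Suc)
  have a0: "0 \<le> a n" for n unfolding a_def using E[of "Suc n"] Ppos by (simp add: less_imp_le)
  have a1: "a n \<le> 1 / P n - 2 / P (Suc n)" for n
  proof -
    have "a n \<le> (real (q (Suc n)) - 2) / P (Suc n)"
      unfolding a_def using Ppos[of "Suc n"] E[of "Suc n"] by (intro divide_right_mono) linarith+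
    also have "\<dots> = 1 / P n - 2 / P (Suc n)"
      using Ppos[of n] q2[of n] by (simp add: PS field_simps)
    finally show ?thesis .
  qed
  \<comment> \<open>The bounds \<open>a1\<close> telescope. The first one leaves
    \<open>2 / P 1\<close> to spare: one half becomes the moving term \<open>1 / P (Suc n)\<close>,
    the other is a fixed margin that survives in the limit.\<close>
  have part: "sum a {..<Suc n} \<le> 1 - 1 / P 1 - 1 / P (Suc n)" for n
  proof (induction n)
    case 0
    then show ?case using a1[of 0] by (simp add: P_def)
  next
    case (Suc n)
    have "2 / P (Suc (Suc n)) = 1 / P (Suc (Suc n)) + 1 / P (Suc (Suc n))" by simp
    moreover have "0 < 1 / P (Suc (Suc n))" using Ppos by simp
    moreover have "sum a {..<Suc (Suc n)} = sum a {..<Suc n} + a (Suc n)" by simp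
    ultimately show ?case using a1[of "Suc n"] Suc by linarith
  qed
  have invP: "0 < 1 / P n" for n using Ppos by simp
  have part1: "sum a {..<n} \<le> 1 - 1 / P 1" for n
  proof -
    have "sum a {..<n} \<le> sum a {..<Suc n}" using a0 by simp
    also have "\<dots> \<le> 1 - 1 / P 1" using part[of n] invP[of "Suc n"] by linarith
    finally show ?thesis .
  qed
  have "summable a"
    using a0 part1 by (intro bounded_imp_summable[of a "1 - 1 / P 1"])
      (auto simp flip: lessThan_Suc_atMost simp del: sum.lessThan_Suc)
  then have sums: "a sums suminf a" by (rule summable_sums)
  have "suminf a \<le> 1 - 1 / P 1" using \<open>summable a\<close> part1 by (rule suminf_le_const)
  then have "suminf a < 1" using invP[of 1] by linarith
  moreover have "0 \<le> suminf a" using \<open>summable a\<close> a0 by (rule suminf_nonneg)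
  ultimately have fl: "\<lfloor>suminf a\<rfloor> = 0" by (simp add: floor_eq_iff)
  have "E n \<noteq> int (q n) - 1" if "1 \<le> n" for n using E[OF that] by linarith
  then have "{1..} \<subseteq> {n. 1 \<le> n \<and> E n \<noteq> int (q n) - 1}" by blast
  then have inf: "infinite {n. 1 \<le> n \<and> E n \<noteq> int (q n) - 1}"
    using infinite_Ici infinite_super by blast
  have "(\<lambda>n. real_of_int (E (Suc n)) / real (\<Prod>i=1..Suc n. q i)) = a"
    by (rule ext) (simp only: a_def P_def of_nat_prod)
  with sums assms(2) have "(\<lambda>n. real_of_int (E (Suc n)) / real (\<Prod>i=1..Suc n. q i)) sums
      (suminf a - real_of_int (E 0))" by simp
  then have "is_cantor_expansion q (suminf a) E"
    unfolding is_cantor_expansion_def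
  proof (intro conjI allI impI)
    fix n :: nat assume "1 \<le> n"
    then show "0 \<le> E n" "E n \<le> int (q n) - 1" using E[of n] by linarith+
  qed (use fl assms(2) inf in simp_all)
  then show ?thesis using cantor_digits_eqI[OF q] by blast
qed

section \<open>Asymptotic comparison of counts, and partial sums of the weights\<close>

lemma tendsto_ratio_1_of_diff_le:
  fixes N A e :: "nat \<Rightarrow> real"
  assumes "filterlim A at_top sequentially"
    and "\<forall>\<^sub>F n in sequentially. \<bar>N n - A n\<bar> \<le> C + e n"
    and "(\<lambda>n. e n / A n) \<longlonglongrightarrow> 0"
  shows "(\<lambda>n. N n / A n) \<longlonglongrightarrow> 1"
proof (rule LIM_zero_cancel, rule tendsto_0_le[where K = 1])
  have "(\<lambda>n. C / A n) \<longlonglongrightarrow> 0"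
    using assms(1) by (intro tendsto_divide_0[OF tendsto_const] filterlim_at_top_imp_at_infinity)
  from tendsto_add[OF this assms(3)] show "(\<lambda>n. C / A n + e n / A n) \<longlonglongrightarrow> 0" by simp
  have "\<forall>\<^sub>F n in sequentially. 0 < A n" using assms(1) unfolding filterlim_at_top_dense by blast
  with assms(2) show "\<forall>\<^sub>F n in sequentially. norm (N n / A n - 1) \<le> norm (C / A n + e n / A n) * 1"
  proof eventually_elim
    case (elim n)
    have "norm (N n / A n - 1) = \<bar>N n - A n\<bar> / A n" using elim by (simp add: field_simps)
    also have "\<dots> \<le> (C + e n) / A n" using elim by (intro divide_right_mono) auto
    also have "\<dots> = C / A n + e n / A n" by (simp add: add_divide_distrib)
    finally show ?case by simp
  qed
qed

text \<open>Only the finitely many indices below some \<open>t0\<close> contribute to the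
  difference.\<close>

lemma abs_sum_diff_bounded:
  fixes f g :: "nat \<Rightarrow> nat"
  assumes "\<forall>\<^sub>F t in sequentially. f t = g t"
  obtains C where "\<And>t. \<bar>real (\<Sum>s<t. f s) - real (\<Sum>s<t. g s)\<bar> \<le> C"
proof -
  obtain t0 where t0: "\<And>t. t0 \<le> t \<Longrightarrow> f t = g t"
    using assms unfolding eventually_sequentially by blast
  have less_t0: "s < t0" if "f s \<noteq> g s" for s
    using t0[of s] that by (cases "s < t0") auto
  have "\<bar>real (\<Sum>s<t. f s) - real (\<Sum>s<t. g s)\<bar> \<le> (\<Sum>s<t0. \<bar>real (f s) - real (g s)\<bar>)" for t
  proof -
    have "\<bar>real (\<Sum>s<t. f s) - real (\<Sum>s<t. g s)\<bar> = \<bar>\<Sum>s<t. real (f s) - real (g s)\<bar>"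
      by (simp add: sum_subtractf)
    also have "\<dots> \<le> (\<Sum>s<t. \<bar>real (f s) - real (g s)\<bar>)" by (rule sum_abs)
    also have "\<dots> = (\<Sum>s\<in>{..<t} \<inter> {..<t0}. \<bar>real (f s) - real (g s)\<bar>)"
      by (rule sum.mono_neutral_right) (auto intro: less_t0)
    also have "\<dots> \<le> (\<Sum>s<t0. \<bar>real (f s) - real (g s)\<bar>)" by (rule sum_mono2) auto
    finally show ?thesis .
  qed
  then show ?thesis by (rule that)
qed

lemma Q_sum_mono:
  assumes "n \<le> n'"
  shows "Q_sum q k n \<le> Q_sum q k n'"
  unfolding Q_sum_def using assms by (intro sum_mono2) (auto intro: prod_nonneg)

lemma Q_sum_pos:
  assumes "basic_seq q" "1 \<le> n"
  shows "0 < Q_sum q k n"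
  unfolding Q_sum_def
proof (rule sum_pos)
  fix j assume j: "j \<in> {1..n}"
  have "0 < q i" if "i \<in> {j..<j + k}" for i
    using assms(1) that j unfolding basic_seq_def
    by (metis atLeastAtMost_iff atLeastLessThan_iff gr0I le_trans not_numeral_le_zero)
  then have "0 < (\<Prod>i\<in>{j..<j + k}. q i)" by (intro prod_pos) blast
  then show "0 < 1 / real (\<Prod>i\<in>{j..<j + k}. q i)" by (simp del: of_nat_prod)
qed (use assms in auto)

section \<open>Construction of the number and its properties\<close>

theorem theorem3p13:
  fixes q :: "nat \<Rightarrow> nat"
  assumes "basic_seq q" and "infinite_in_limit q"
  shows "ratio_normal_set q - (\<Union>k\<in>{1..}. normal_order q k) \<noteq> {} \<and>
         ratio_normal_set q - normal_set q \<noteq> {}"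
proof -
  obtain m :: "nat \<Rightarrow> nat" where m_lim: "filterlim m at_top sequentially"
    and slow: "\<And>t. m t * length (round_word (m t)) \<le> t"
    using slow_sequence_exists[of "\<lambda>m. length (round_word m)"] by blast
  define u where "u t = round_word (m t)" for t
  define S where "S t = (\<Sum>s<t. length (u s))" for t
  have q_large: "\<forall>\<^sub>F n in sequentially. d \<le> q n" for d
    using assms(2) unfolding infinite_in_limit_def filterlim_at_top by blast
  \<comment> \<open>Threshold for starting round \<open>t\<close>. Letters below \<open>m t\<close>
    then satisfy the digit bound \<open>q n - 2\<close>, and the weights before position
    \<open>n\<close> amount to twice the total length \<open>S t\<close> of the earlier rounds. The
    extra \<open>t\<close> will absorb a constant. Restricting to \<open>k \<le> t\<close> leaves
    finitely many conditions, yet each \<open>k\<close> is covered from some round on.\<close>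
  have "\<exists>b. \<forall>n\<ge>b. m t < q n \<and> (\<forall>k\<le>t. (\<forall>M. \<exists>n. M \<le> Q_sum q k n) \<longrightarrow>
      real (2 * (S t + t)) \<le> Q_sum q k (n - 1))" for t
  proof -
    have "\<exists>b. \<forall>n\<ge>b. (\<forall>M. \<exists>n. M \<le> Q_sum q k n) \<longrightarrow> real (2 * (S t + t)) \<le> Q_sum q k (n - 1)" for k
    proof (cases "\<forall>M. \<exists>n. M \<le> Q_sum q k n")
      case True
      then obtain n0 where "real (2 * (S t + t)) \<le> Q_sum q k n0" by blast
      then have "\<forall>n\<ge>Suc n0. real (2 * (S t + t)) \<le> Q_sum q k (n - 1)"
        using Q_sum_mono[of n0 _ q k] by (metis Suc_leD Suc_le_D diff_Suc_1 order_trans not_less_eq_eq)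
      then show ?thesis by blast
    qed blast
    then have "\<forall>\<^sub>F n in sequentially. (\<forall>M. \<exists>n. M \<le> Q_sum q k n) \<longrightarrow>
        real (2 * (S t + t)) \<le> Q_sum q k (n - 1)" for k
      unfolding eventually_sequentially by blast
    then have "\<forall>\<^sub>F n in sequentially. \<forall>k\<in>{..t}. (\<forall>M. \<exists>n. M \<le> Q_sum q k n) \<longrightarrow>
        real (2 * (S t + t)) \<le> Q_sum q k (n - 1)"
      by (intro eventually_ball_finite) auto
    with q_large[of "Suc (m t)"] show ?thesis
      unfolding eventually_sequentially[symmetric] by eventually_elim auto
  qed
  then obtain b where b: "\<And>t n. b t \<le> n \<Longrightarrow> m t < q n"
      "\<And>t n k. b t \<le> n \<Longrightarrow> k \<le> t \<Longrightarrow> (\<forall>M. \<exists>n. M \<le> Q_sum q k n) \<Longrightarrow>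
        real (2 * (S t + t)) \<le> Q_sum q k (n - 1)"
    by metis
  \<comment> \<open>Summing all thresholds gives \<open>b t \<le> p t\<close>; the second sum makes
    room for the words and a separator each. The outer \<open>Suc\<close> keeps letters away from
    position 0, the integer part.\<close>
  define p where "p t = Suc ((\<Sum>s\<le>t. b s) + (\<Sum>s<t. Suc (length (u s))))" for t
  have p_b: "b t \<le> p t" for t
    by (cases t) (simp_all add: p_def)
  interpret sparse_layout p u
    by unfold_locales (simp add: p_def)
  define E where "E n = (if n = 0 then 0 else
    case symbol n of Some d \<Rightarrow> int d | None \<Rightarrow> int (q n) - 2)" for n
  have q2: "2 \<le> q n" if "1 \<le> n" for n using assms(1) that unfolding basic_seq_def by blast
  have E_bounds: "0 \<le> E n \<and> E n \<le> int (q n) - 2" if n: "1 \<le> n" for n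
  proof (cases "symbol n")
    case None
    then show ?thesis using q2[OF n] n by (simp add: E_def)
  next
    case (Some d)
    then obtain t where t: "p t \<le> n" "Some d \<in> set (u t)" by (rule symbol_SomeD)
    then have "d < m t" unfolding u_def by (intro round_word_digit)
    moreover have "m t < q n" using b(1)[of t n] p_b[of t] t by simp
    ultimately show ?thesis using Some n by (simp add: E_def)
  qed
  obtain x where x: "cantor_digits q x = E"
    using cantor_digits_surj[OF assms(1), of E] E_bounds by (auto simp: E_def)
  \<comment> \<open>The digits of \<open>x\<close> may contain \<open>B\<close> also where gap
    digits happen to agree with it, but only at finitely many starting positions.\<close>
  have "\<exists>C::nat. \<forall>n. card {i. i \<le> n \<and> matches B i} \<le> block_count q B x n \<and>
      block_count q B x n \<le> card {i. i \<le> n \<and> matches B i} + C" if B: "B \<noteq> []" for B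
  proof -
    \<comment> \<open>With 3 to spare, the gap digit \<open>q n - 2\<close> is larger than every
      entry of \<open>B\<close>.\<close>
    obtain n0 where n0: "\<And>n. n0 \<le> n \<Longrightarrow> Max (set B) + 3 \<le> q n"
      using q_large[of "Max (set B) + 3"] unfolding eventually_sequentially by blast
    have "card {i. i \<le> n \<and> matches B i} \<le> block_count q B x n \<and>
        block_count q B x n \<le> card {i. i \<le> n \<and> matches B i} + card {..<n0}" for n
    proof
      have pos: "1 \<le> i" if "matches B i" for i
        using not_matches_before[OF B, of i] that by (cases i) (auto simp: p_def)
      have "E (i + j) = int (B ! j)" if "matches B i" "j < length B" for i j
        using pos[OF that(1)] that by (simp add: E_def matches_def)
      with pos have "{i. i \<le> n \<and> matches B i} \<subseteq> {i \<in> {1..n}. \<forall>j<length B. E (i + j) = int (B ! j)}"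
        by auto
      then show "card {i. i \<le> n \<and> matches B i} \<le> block_count q B x n"
        unfolding block_count_def x by (intro card_mono) auto
      have "matches B i" if i: "1 \<le> i" "n0 \<le> i" "\<forall>j<length B. E (i + j) = int (B ! j)" for i
        unfolding matches_def
      proof (intro allI impI)
        fix j assume j: "j < length B"
        then have "B ! j \<le> Max (set B)" by simp
        moreover have "Max (set B) + 3 \<le> q (i + j)" using n0 i by simp
        moreover have "E (i + j) = int (B ! j)" using i j by blast
        ultimately show "symbol (i + j) = Some (B ! j)"
          using i(1) by (simp add: E_def split: option.splits if_splits)
      qed
      then have "i < n0 \<or> matches B i" if "1 \<le> i" "\<forall>j<length B. E (i + j) = int (B ! j)" for i
        using that by (cases "i < n0") auto
      then have "{i \<in> {1..n}. \<forall>j<length B. E (i + j) = int (B ! j)} \<subseteq>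
          {i. i \<le> n \<and> matches B i} \<union> {..<n0}"
        by auto
      then have "block_count q B x n \<le> card ({i. i \<le> n \<and> matches B i} \<union> {..<n0})"
        unfolding block_count_def x by (intro card_mono) auto
      also have "\<dots> \<le> card {i. i \<le> n \<and> matches B i} + card {..<n0}" by (rule card_Un_le)
      finally show "block_count q B x n \<le> card {i. i \<le> n \<and> matches B i} + card {..<n0}" .
    qed
    then show ?thesis by blast
  qed
  then obtain C :: "nat list \<Rightarrow> nat" where
    C1: "\<And>B n. B \<noteq> [] \<Longrightarrow> card {i. i \<le> n \<and> matches B i} \<le> block_count q B x n" and
    C2: "\<And>B n. B \<noteq> [] \<Longrightarrow> block_count q B x n \<le> card {i. i \<le> n \<and> matches B i} + C B"
    by metis
  \<comment> \<open>The block of \<open>k\<close> zeros serves as a common yardstick for all blocks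
    of length \<open>k\<close>; \<open>A k n\<close> counts it in the rounds completed before the
    current stage.\<close>
  define c where "c k t = occurrences (map Some (replicate k 0)) (u t)" for k t
  define A where "A k n = real (\<Sum>s<stage n. c k s)" for k n
  have A_lim: "filterlim (A k) at_top sequentially" if "1 \<le> k" for k
    unfolding A_def c_def u_def
    using filterlim_compose[OF filterlim_sum_occurrences[OF m_lim, of "replicate k 0"] filterlim_stage] that
    by simp
  have count_lim: "(\<lambda>n. real (block_count q B x n) / A k n) \<longlonglongrightarrow> 1"
    if k: "1 \<le> k" and B: "length B = k" for k B
  proof -
    have B': "B \<noteq> []" using k B by auto
    have k0: "replicate k (0::nat) \<noteq> []" using k by simp
    have ev: "\<forall>\<^sub>F t in sequentially. occurrences (map Some B) (u t) = c k t"
      unfolding c_def u_def using B' B by (intro eventually_occurrences_eq[OF m_lim]) auto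
    obtain D where D: "\<And>t. \<bar>real (\<Sum>s<t. occurrences (map Some B) (u s)) - real (\<Sum>s<t. c k s)\<bar> \<le> D"
      using abs_sum_diff_bounded[OF ev] by blast
    show ?thesis
    proof (rule tendsto_ratio_1_of_diff_le[OF A_lim[OF k]])
      show "(\<lambda>n. real (c k (stage n)) / A k n) \<longlonglongrightarrow> 0"
        unfolding A_def c_def u_def
        using filterlim_compose[OF occurrences_div_sum_tendsto_0[OF m_lim k0 slow] filterlim_stage]
        by simp
      \<comment> \<open>Three errors arise: \<open>D\<close> from early rounds whose alphabet is too
        small for \<open>B\<close>, \<open>C B\<close> from accidental matches with gap digits, and
        the current round.\<close>
      show "\<forall>\<^sub>F n in sequentially. \<bar>real (block_count q B x n) - A k n\<bar> \<le>
          (D + real (C B)) + real (c k (stage n))"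
        using eventually_ge_at_top[of "p 0"]
      proof eventually_elim
        case (elim n)
        have "real (\<Sum>s<stage n. occurrences (map Some B) (u s)) \<le> real (block_count q B x n)"
          using card_matches_bounds(1)[OF B' elim] C1[OF B', of n] by linarith
        moreover have "real (block_count q B x n) \<le>
            real (\<Sum>s<Suc (stage n). occurrences (map Some B) (u s)) + real (C B)"
          using card_matches_bounds(2)[OF B' elim] C2[OF B', of n] by linarith
        moreover have "real (\<Sum>s<Suc (stage n). c k s) = A k n + real (c k (stage n))"
          by (simp add: A_def)
        ultimately show ?case
          using D[of "stage n"] D[of "Suc (stage n)"] unfolding A_def by linarith
      qed
    qed
  qed
  have ratio: "x \<in> ratio_normal_set q"
    unfolding ratio_normal_set_def
  proof (clarify)
    fix B1 B2 :: "nat list" assume k: "1 \<le> length B1" and len: "length B2 = length B1"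
    let ?k = "length B1"
    have "(\<lambda>n. (real (block_count q B1 x n) / A ?k n) / (real (block_count q B2 x n) / A ?k n)) \<longlonglongrightarrow> 1 / 1"
      using k len by (intro tendsto_divide count_lim) auto
    moreover have "\<forall>\<^sub>F n in sequentially. 0 < A ?k n"
      using A_lim[OF k] unfolding filterlim_at_top_dense by blast
    then have "\<forall>\<^sub>F n in sequentially.
        (real (block_count q B1 x n) / A ?k n) / (real (block_count q B2 x n) / A ?k n) =
        real (block_count q B1 x n) / real (block_count q B2 x n)"
      by eventually_elim simp
    ultimately show "(\<lambda>n. real (block_count q B1 x n) / real (block_count q B2 x n)) \<longlonglongrightarrow> 1"
      unfolding div_by_1 by (rule Lim_transform_eventually)
  qed
  have not_normal: "x \<notin> normal_order q k" if k: "1 \<le> k" for k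
  proof
    define B where "B = replicate k (0::nat)"
    have B: "B \<noteq> []" "length B = k" using k by (auto simp: B_def)
    assume "x \<in> normal_order q k"
    then have lim: "(\<lambda>n. real (block_count q B x n) / Q_sum q k n) \<longlonglongrightarrow> 1"
      using B unfolding normal_order_def by blast
    show False
    proof (cases "\<forall>M. \<exists>n. M \<le> Q_sum q k n")
      case True
      \<comment> \<open>Look just before round \<open>t\<close> begins: the long gap has raised
        \<open>Q_sum\<close>, while only the earlier rounds have been counted.\<close>
      have "strict_mono (\<lambda>t. p t - 1)"
        unfolding strict_mono_Suc_iff by (simp add: p_def)
      then have "filterlim (\<lambda>t. p t - 1) at_top sequentially" by (rule filterlim_subseq)
      from filterlim_compose[OF lim this]
      have "(\<lambda>t. real (block_count q B x (p t - 1)) / Q_sum q k (p t - 1)) \<longlonglongrightarrow> 1" .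
      then have "\<forall>\<^sub>F t in sequentially. 1/2 < real (block_count q B x (p t - 1)) / Q_sum q k (p t - 1)"
        by (rule order_tendstoD) simp
      then have "\<forall>\<^sub>F t in sequentially. False"
        \<comment> \<open>\<open>k \<le> t\<close> makes the threshold apply to this
          \<open>k\<close>, \<open>C B \<le> t\<close> absorbs the accidental matches, and
          \<open>0 < t\<close> makes \<open>Q_sum\<close> positive. The ratio is then at most
          1/2.\<close>
        using eventually_ge_at_top[of "C B + k"]
      proof eventually_elim
        case (elim t)
        have Q: "real (2 * (S t + t)) \<le> Q_sum q k (p t - 1)"
          using b(2)[OF p_b _ True] elim by simp
        have "block_count q B x (p t - 1) \<le> card {i. i \<le> p t - 1 \<and> matches B i} + C B"
          by (rule C2[OF B(1)])
        also have "{i. i \<le> p t - 1 \<and> matches B i} = {i. i < p t \<and> matches B i}"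
          by (auto simp: p_def)
        also have "card \<dots> = (\<Sum>s<t. occurrences (map Some B) (u s))"
          by (rule card_matches_below[OF B(1)])
        also have "\<dots> \<le> S t" unfolding S_def by (intro sum_mono occurrences_le_length)
        finally have "real (block_count q B x (p t - 1)) \<le> real (S t + t)" using elim by simp
        then have "2 * real (block_count q B x (p t - 1)) \<le> Q_sum q k (p t - 1)" using Q by simp
        moreover have "0 < Q_sum q k (p t - 1)" using Q elim k by simp
        ultimately show ?case using elim(1) by (simp add: field_simps)
      qed
      then show False by simp
    next
      case False
      then obtain M where M: "\<And>n. Q_sum q k n < M" by (auto simp: not_le)
      have "filterlim (\<lambda>n. A k n * (real (block_count q B x n) / A k n)) at_top sequentially"
        using filterlim_tendsto_pos_mult_at_top[OF count_lim[OF k B(2)] _ A_lim[OF k]]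
        by (simp add: mult.commute)
      moreover have "\<forall>\<^sub>F n in sequentially. 0 < A k n"
        using A_lim[OF k] unfolding filterlim_at_top_dense by blast
      then have "\<forall>\<^sub>F n in sequentially.
          A k n * (real (block_count q B x n) / A k n) = real (block_count q B x n)"
        by eventually_elim simp
      ultimately have "filterlim (\<lambda>n. real (block_count q B x n)) at_top sequentially"
        by (simp only: filterlim_cong)
      then have "\<forall>\<^sub>F n in sequentially. 2 * M \<le> real (block_count q B x n)"
        unfolding filterlim_at_top by blast
      moreover have "\<forall>\<^sub>F n in sequentially. real (block_count q B x n) / Q_sum q k n < 2"
        using lim by (rule order_tendstoD) simp
      ultimately have "\<forall>\<^sub>F n in sequentially. False"
        using eventually_ge_at_top[of 1]
      proof eventually_elim
        case (elim n)
        then show ?case using M[of n] Q_sum_pos[OF assms(1) elim(3), of k] by (simp add: field_simps)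
      qed
      then show False by simp
    qed
  qed
  have "x \<notin> (\<Union>k\<in>{1..}. normal_order q k)" using not_normal by auto
  moreover have "x \<notin> normal_set q" unfolding normal_set_def using not_normal[of 1] by auto
  ultimately show ?thesis using ratio by blast
qed

end
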